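(* Let $E$ be a Banach lattice. The following are equivalent: (1) the lattice operations of $E$ are sequentially weakly continuous; (2) for every sequence $(x_n)\subset E$, if $x_n\to 0$ weakly then $x_n\xrightarrow{uaw}0$.
   Context: $E^+$ denotes the positive cone of $E$. A net (or sequence) $(x_\alpha)$ in a Banach lattice $E$ is $uaw$-convergent (unbounded absolutely weakly convergent) to $x\in E$, written $x_\alpha\xrightarrow{uaw}x$, if for every $u\in E^+$ the net $|x_\alpha-x|\wedge u$ converges to $0$ weakly. The lattice operations of $E$ are sequentially weakly continuous if for every sequence $(x_n)\subset E$, $x_n\to0$ weakly implies $|x_n|\to 0$ weakly. *)

theory Defs
  imports "HOL-Analysis.Analysis" "HOL-Library.Lattice_Algebras"
begin

text \<open>Real Banach lattices. The modulus is \<open>\<bar>x\<bar> = sup x (- x)\<close>, by the class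
  \<open>lattice_ab_group_add_abs\<close>.\<close>

class banach_lattice = banach + ordered_real_vector + lattice_ab_group_add_abs +
  assumes norm_mono_abs: "\<bar>x\<bar> \<le> \<bar>y\<bar> \<Longrightarrow> norm x \<le> norm y"

instance real :: banach_lattice
  by standard simp

text \<open>Convergence of nets is expressed with filters; the filter \<open>sequentially\<close> gives
  sequences. The topological dual is the type of bounded linear functionals.\<close>

definition weakly_tendsto ::
  "('i \<Rightarrow> 'a::real_normed_vector) \<Rightarrow> 'a \<Rightarrow> 'i filter \<Rightarrow> bool"
  where "weakly_tendsto x l F \<longleftrightarrow>
    (\<forall>\<phi> :: 'a \<Rightarrow>\<^sub>L real. ((\<lambda>i. blinfun_apply \<phi> (x i)) \<longlongrightarrow> blinfun_apply \<phi> l) F)"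

definition uaw_tendsto ::
  "('i \<Rightarrow> 'a::banach_lattice) \<Rightarrow> 'a \<Rightarrow> 'i filter \<Rightarrow> bool"
  where "uaw_tendsto x l F \<longleftrightarrow>
    (\<forall>u\<ge>0. weakly_tendsto (\<lambda>i. inf \<bar>x i - l\<bar> u) 0 F)"

definition lattice_ops_seq_weakly_continuous :: "'a::banach_lattice itself \<Rightarrow> bool"
  where "lattice_ops_seq_weakly_continuous (_ :: 'a itself) \<longleftrightarrow>
    (\<forall>x :: nat \<Rightarrow> 'a. weakly_tendsto x 0 sequentially \<longrightarrow>
      weakly_tendsto (\<lambda>n. \<bar>x n\<bar>) 0 sequentially)"

end

theory Submission
  imports Defs
begin

text \<open>Write \<open>F\<close> for a positive functional dominating the modulus of a given functional, so that
  \<open>F \<bar>\<cdot>\<bar>\<close> is a seminorm of \<open>L\<^sup>1\<close> type. If \<open>x\<^sub>n\<close> is weakly null and uaw-null but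
  \<open>F \<bar>x\<^sub>n\<bar>\<close> does not tend to 0, then normalising and passing to a subsequence yields a weakly
  null sequence \<open>y\<^sub>k\<close> with \<open>F \<bar>y\<^sub>k\<bar> = 1\<close> which is almost disjoint with respect to \<open>F\<close>.
  It therefore dominates the unit basis of \<open>\<ell>\<^sup>1\<close> on nonnegative coefficients:
  \<open>F \<bar>\<Sum> c\<^sub>k y\<^sub>k\<bar> \<ge> (\<Sum> c\<^sub>k) / 2\<close>. A Hahn--Banach argument turns this into a functional
  \<open>g \<le> F \<bar>\<cdot>\<bar>\<close> with \<open>g y\<^sub>k \<ge> 1/2\<close> for all \<open>k\<close>, contradicting weak nullity.\<close>

section \<open>Linear functionals below a sublinear one\<close>

definition sublinear :: "('a::real_vector \<Rightarrow> real) \<Rightarrow> bool" where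
  "sublinear p \<longleftrightarrow> (\<forall>x y. p (x + y) \<le> p x + p y) \<and> (\<forall>c\<ge>0. \<forall>x. p (c *\<^sub>R x) = c * p x)"

lemma sublinear_add: "sublinear p \<Longrightarrow> p (x + y) \<le> p x + p y"
  and sublinear_scaleR: "sublinear p \<Longrightarrow> 0 \<le> c \<Longrightarrow> p (c *\<^sub>R x) = c * p x"
  by (auto simp: sublinear_def)

lemma sublinear_zero: "sublinear p \<Longrightarrow> p 0 = 0"
  using sublinear_scaleR[of p 0 0] by simp

lemma sublinear_minus: "sublinear p \<Longrightarrow> - p (- x) \<le> p x"
  using sublinear_add[of p x "- x"] by (simp add: sublinear_zero)

text \<open>The inequality for \<open>c > 0\<close> suffices: applied to \<open>inverse c\<close>
  and the vector \<open>c *\<^sub>R x\<close> it gives the reverse one.\<close>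

lemma sublinearI:
  assumes "\<And>x y. p (x + y) \<le> p x + p y" and "p 0 = 0"
    and scale: "\<And>c x. 0 < c \<Longrightarrow> p (c *\<^sub>R x) \<le> c * p x"
  shows "sublinear p"
proof -
  have "p (c *\<^sub>R x) = c * p x" if "c \<ge> 0" for c x
  proof (cases "c = 0")
    case False
    with that have c: "c > 0" by simp
    have "p (inverse c *\<^sub>R (c *\<^sub>R x)) \<le> inverse c * p (c *\<^sub>R x)"
      using c by (intro scale) simp
    with c have "c * p x \<le> p (c *\<^sub>R x)"
      by (simp add: field_simps)
    with scale[OF c, of x] show ?thesis by simp
  qed (use assms in simp)
  with assms(1) show ?thesis
    by (simp add: sublinear_def)
qed

lemma sublinear_odd_imp_linear:
  assumes p: "sublinear p" and odd: "\<And>x. p (- x) \<le> - p x"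
  shows "linear p"
proof (rule linearI)
  have neg: "p (- x) = - p x" for x
    using odd[of x] sublinear_minus[OF p, of x] by linarith
  show "p (x + y) = p x + p y" for x y
    using sublinear_add[OF p, of x y] sublinear_add[OF p, of "x + y" "- y"] neg[of y] by simp
  show "p (c *\<^sub>R x) = c *\<^sub>R p x" for c x
  proof (cases "c \<ge> 0")
    case False
    then have "p ((- c) *\<^sub>R (- x)) = - c * p (- x)"
      by (intro sublinear_scaleR[OF p]) simp
    then show ?thesis by (simp add: neg)
  qed (simp add: sublinear_scaleR[OF p])
qed

section \<open>Hahn--Banach with a cone of lower bounds\<close>

lemma convex_cone_prodI:
  assumes "(0, 0) \<in> K"
    and "\<And>s t s' t'. (s, t) \<in> K \<Longrightarrow> (s', t') \<in> K \<Longrightarrow> (s + s', t + t') \<in> K"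
    and "\<And>c s t. 0 \<le> c \<Longrightarrow> (s, t) \<in> K \<Longrightarrow> (c *\<^sub>R s, c *\<^sub>R t) \<in> K"
  shows "convex_cone K"
  unfolding convex_cone_iff using assms by (auto simp: zero_prod_def)

text \<open>A pair \<open>(s, t)\<close> in \<open>K\<close> encodes the demand
  \<open>t \<le> g s\<close> on a functional \<open>g\<close>. Lowering \<open>p\<close> to
  \<open>q\<close> builds these demands in: a linear \<open>g\<close> below \<open>q\<close> has
  \<open>g (- s) \<le> - t\<close>.\<close>

lemma sublinear_below_on_cone:
  fixes p :: "'a::real_vector \<Rightarrow> real"
  assumes p: "sublinear p" and K: "convex_cone K"
    and dom: "\<And>s t. (s, t) \<in> K \<Longrightarrow> t \<le> p s"
  shows "\<exists>q. sublinear q \<and> (\<forall>x. q x \<le> p x) \<and> (\<forall>s t. (s, t) \<in> K \<longrightarrow> q (- s) \<le> - t)"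
proof -
  define q where "q x = (INF (s, t)\<in>K. p (x + s) - t)" for x
  \<comment> \<open>The infimum is finite because
    \<open>t \<le> p s \<le> p (x + s) + p (- x)\<close>.\<close>
  have lower: "- p (- x) \<le> p (x + s) - t" if "(s, t) \<in> K" for x s t
    using dom[OF that] sublinear_add[OF p, of "x + s" "- x"] by simp
  have bdd: "bdd_below ((\<lambda>(s, t). p (x + s) - t) ` K)" for x
    using lower by (intro bdd_belowI2[of _ "- p (- x)"]) auto
  have q_le: "q x \<le> p (x + s) - t" if "(s, t) \<in> K" for x s t
    unfolding q_def using cINF_lower[OF bdd that] by simp
  have le_q: "r \<le> q x" if "\<And>s t. (s, t) \<in> K \<Longrightarrow> r \<le> p (x + s) - t" for r x
    unfolding q_def using that convex_cone_nonempty[OF K] by (intro cINF_greatest) auto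
  have zero: "(0, 0) \<in> K"
    using convex_cone_contains_0[OF K] by (simp add: zero_prod_def)
  have "sublinear q"
  proof (rule sublinearI)
    show "q (x + y) \<le> q x + q y" for x y
    proof -
      \<comment> \<open>With the two pairs independent, the infimum can be taken over
        \<open>(s', t')\<close> first and over \<open>(s, t)\<close> afterwards.\<close>
      have "q (x + y) - (p (x + s) - t) \<le> p (y + s') - t'" if st: "(s, t) \<in> K" "(s', t') \<in> K" for s t s' t'
      proof -
        have "(s + s', t + t') \<in> K"
          using convex_cone_add[OF K st] by simp
        from q_le[OF this, of "x + y"] sublinear_add[OF p, of "x + s" "y + s'"]
        show ?thesis by (simp add: algebra_simps)
      qed
      then have "q (x + y) - (p (x + s) - t) \<le> q y" if "(s, t) \<in> K" for s t
        using that by (intro le_q) blast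
      then have "q (x + y) - q y \<le> q x"
        by (intro le_q) (smt (verit))
      then show ?thesis by simp
    qed
    show "q 0 = 0"
    proof (rule order_antisym)
      show "q 0 \<le> 0"
        using q_le[OF zero, of 0] by (simp add: sublinear_zero[OF p])
      show "0 \<le> q 0"
        by (rule le_q) (simp add: dom)
    qed
    show "q (c *\<^sub>R x) \<le> c * q x" if "c > 0" for c x
    proof -
      have "q (c *\<^sub>R x) / c \<le> p (x + s) - t" if st: "(s, t) \<in> K" for s t
      proof -
        have "(c *\<^sub>R s, c * t) \<in> K"
          using convex_cone_scaleR[OF K _ st, of c] \<open>c > 0\<close> by simp
        from q_le[OF this, of "c *\<^sub>R x"] sublinear_scaleR[OF p, of c "x + s"] \<open>c > 0\<close>
        show ?thesis by (simp add: field_simps)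
      qed
      then have "q (c *\<^sub>R x) / c \<le> q x" by (intro le_q)
      with that show ?thesis by (simp add: field_simps)
    qed
  qed
  moreover have "q x \<le> p x" for x
    using q_le[OF zero, of x] by simp
  moreover have "q (- s) \<le> - t" if "(s, t) \<in> K" for s t
    using q_le[OF that, of "- s"] by (simp add: sublinear_zero[OF p])
  ultimately show ?thesis by blast
qed

text \<open>Zorn's lemma gives a minimal sublinear functional below \<open>p\<close>; minimality
  forces it to be odd, hence linear.\<close>

lemma linear_below_sublinear:
  fixes p :: "'a::real_vector \<Rightarrow> real"
  assumes p: "sublinear p"
  shows "\<exists>g. linear g \<and> (\<forall>x. g x \<le> p x)"
proof -
  define A where "A = {q. sublinear q \<and> q \<le> p}"
  have "\<exists>m\<in>A. \<forall>q\<in>A. q \<le> m \<longrightarrow> q = m"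
  proof (rule predicate_Zorn)
    \<comment> \<open>The order is reversed, so that Zorn's maximal element is a minimal
      functional.\<close>
    show "partial_order_on A (relation_of (\<lambda>a b. b \<le> a) A)"
      by (rule partial_order_on_relation_ofI) auto
    fix C assume C: "C \<in> Chains (relation_of (\<lambda>a b. b \<le> a) A)"
    then have CA: "q \<in> A" if "q \<in> C" for q
      using that by (auto simp: Chains_def relation_of_def)
    have chain: "q \<le> r \<or> r \<le> q" if "q \<in> C" "r \<in> C" for q r
      using that C by (auto simp: Chains_def relation_of_def)
    show "\<exists>u\<in>A. \<forall>a\<in>C. u \<le> a"
    proof (cases "C = {}")
      case True
      with p show ?thesis by (auto simp: A_def)
    next
      case False
      define u where "u x = (INF q\<in>C. q x)" for x
      have lower: "- p (- x) \<le> q x" if "q \<in> C" for q x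
        using CA[OF that] sublinear_minus[of q x] le_funD[of q p "- x"] by (simp add: A_def)
      have u_le: "u x \<le> q x" if "q \<in> C" for q x
        unfolding u_def using lower that by (intro cINF_lower bdd_belowI2[of _ "- p (- x)"])
      have le_u: "r \<le> u x" if "\<And>q. q \<in> C \<Longrightarrow> r \<le> q x" for r x
        unfolding u_def using that False by (intro cINF_greatest)
      have "sublinear u"
      proof (rule sublinearI)
        show "u (x + y) \<le> u x + u y" for x y
        proof -
          \<comment> \<open>The bounds at \<open>x\<close> and \<open>y\<close> may come from
            different members of the chain; the smaller of the two, \<open>w\<close>, serves both
            points.\<close>
          have "u (x + y) - q x \<le> r y" if qr: "q \<in> C" "r \<in> C" for q r
          proof -
            from chain[OF qr] obtain w where w: "w \<in> C" "w \<le> q" "w \<le> r"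
              using qr by auto
            with CA[OF w(1)] have "u (x + y) \<le> w x + w y"
              using u_le[OF w(1), of "x + y"] sublinear_add[of w x y] by (simp add: A_def)
            with le_funD[OF w(2), of x] le_funD[OF w(3), of y] show ?thesis by simp
          qed
          then have "u (x + y) - q x \<le> u y" if "q \<in> C" for q
            using that by (intro le_u)
          then have "u (x + y) - u y \<le> u x"
            by (intro le_u) (smt (verit))
          then show ?thesis by simp
        qed
        from False obtain q where q: "q \<in> C" by blast
        have zero: "r 0 = 0" if "r \<in> C" for r
          using CA[OF that] by (simp add: A_def sublinear_zero)
        show "u 0 = 0"
        proof (rule order_antisym)
          show "u 0 \<le> 0" using u_le[OF q, of 0] zero[OF q] by simp
          show "0 \<le> u 0" by (rule le_u) (simp add: zero)
        qed
        show "u (c *\<^sub>R x) \<le> c * u x" if "c > 0" for c x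
        proof -
          have "u (c *\<^sub>R x) / c \<le> q x" if "q \<in> C" for q
            using u_le[OF that, of "c *\<^sub>R x"] CA[OF that] sublinear_scaleR[of q c x] \<open>c > 0\<close>
            by (simp add: A_def field_simps)
          then have "u (c *\<^sub>R x) / c \<le> u x" by (intro le_u)
          with that show ?thesis by (simp add: field_simps)
        qed
      qed
      moreover have "u \<le> p"
      proof (rule le_funI)
        fix x
        from False obtain q where q: "q \<in> C" by blast
        have "u x \<le> q x" by (rule u_le[OF q])
        also have "q x \<le> p x" using CA[OF q] by (simp add: A_def le_fun_def)
        finally show "u x \<le> p x" .
      qed
      ultimately show ?thesis
        using u_le by (auto simp: A_def le_fun_def)
    qed
  qed
  then obtain m where m: "sublinear m" "m \<le> p"
    and min: "\<And>q. sublinear q \<Longrightarrow> q \<le> m \<Longrightarrow> q = m"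
    unfolding A_def by (metis (mono_tags, lifting) mem_Collect_eq order_trans)
  \<comment> \<open>Lowering a minimal \<open>m\<close> along the ray of \<open>(y, m y)\<close> changes nothing, so \<open>m\<close> is odd.\<close>
  have "m (- y) \<le> - m y" for y
  proof -
    let ?K = "{(t *\<^sub>R y, t * m y) |t. 0 \<le> t}"
    have "convex_cone ?K"
    proof (rule convex_cone_prodI)
      show "(0, 0) \<in> ?K"
        by (auto intro!: exI[of _ 0])
      show "(u + u', v + v') \<in> ?K" if uv: "(u, v) \<in> ?K" "(u', v') \<in> ?K" for u v u' v'
      proof -
        from uv obtain a b where "u = a *\<^sub>R y" "v = a * m y" "0 \<le> a"
          "u' = b *\<^sub>R y" "v' = b * m y" "0 \<le> b"
          by blast
        then show ?thesis by (auto intro!: exI[of _ "a + b"] simp: algebra_simps)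
      qed
      show "(c *\<^sub>R u, c *\<^sub>R v) \<in> ?K" if c: "0 \<le> c" and uv: "(u, v) \<in> ?K" for c u v
      proof -
        from uv obtain a where "u = a *\<^sub>R y" "v = a * m y" "0 \<le> a" by blast
        with c show ?thesis by (auto intro!: exI[of _ "c * a"])
      qed
    qed
    moreover have "t \<le> m s" if "(s, t) \<in> ?K" for s t
      using that sublinear_scaleR[OF m(1)] by auto
    ultimately obtain q where q: "sublinear q" "\<And>x. q x \<le> m x"
      and qK: "\<And>s t. (s, t) \<in> ?K \<Longrightarrow> q (- s) \<le> - t"
      using sublinear_below_on_cone[OF m(1), of ?K] by blast
    have "q = m"
      using q by (intro min le_funI)
    moreover have "(y, m y) \<in> ?K"
      by (auto intro!: exI[of _ 1])
    ultimately show ?thesis using qK by blast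
  qed
  then show ?thesis
    using sublinear_odd_imp_linear[OF m(1)] m(2) by (auto simp: le_fun_def)
qed

lemma linear_between_cone_and_sublinear:
  fixes p :: "'a::real_vector \<Rightarrow> real"
  assumes "sublinear p" and "convex_cone K" and "\<And>s t. (s, t) \<in> K \<Longrightarrow> t \<le> p s"
  shows "\<exists>g. linear g \<and> (\<forall>x. g x \<le> p x) \<and> (\<forall>s t. (s, t) \<in> K \<longrightarrow> t \<le> g s)"
proof -
  obtain q where q: "sublinear q" "\<And>x. q x \<le> p x" "\<And>s t. (s, t) \<in> K \<Longrightarrow> q (- s) \<le> - t"
    using sublinear_below_on_cone[OF assms] by metis
  obtain g where g: "linear g" "\<And>x. g x \<le> q x"
    using linear_below_sublinear[OF q(1)] by metis
  have "t \<le> g s" if "(s, t) \<in> K" for s t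
    using q(3)[OF that] g(2)[of "- s"] linear_neg[OF g(1), of s] by simp
  moreover have "g x \<le> p x" for x
    using g(2) q(2) order_trans by blast
  ultimately show ?thesis using g(1) by blast
qed

text \<open>Continuity is inherited from \<open>p\<close>: apply \<open>g \<le> p\<close> at
  \<open>x\<close> and at \<open>- x\<close>.\<close>

corollary blinfun_between_cone_and_sublinear:
  fixes p :: "'a::real_normed_vector \<Rightarrow> real"
  assumes "sublinear p" and "convex_cone K" and "\<And>s t. (s, t) \<in> K \<Longrightarrow> t \<le> p s"
    and bound: "\<And>x. p x \<le> norm x * B"
  shows "\<exists>g :: 'a \<Rightarrow>\<^sub>L real. (\<forall>x. g x \<le> p x) \<and> (\<forall>s t. (s, t) \<in> K \<longrightarrow> t \<le> g s)"
proof -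
  obtain g where g: "linear g" "\<And>x. g x \<le> p x" "\<And>s t. (s, t) \<in> K \<Longrightarrow> t \<le> g s"
    using linear_between_cone_and_sublinear[OF assms(1-3)] by metis
  have "norm (g x) \<le> norm x * B" for x
    using g(2)[of x] g(2)[of "- x"] bound[of x] bound[of "- x"] linear_neg[OF g(1), of x] by simp
  then have "bounded_linear g"
    using g(1) by (intro bounded_linear_intro[of g B]) (auto simp: linear_add linear_scale)
  then show ?thesis
    using g by (intro exI[of _ "Blinfun g"]) (simp add: bounded_linear_Blinfun_apply)
qed

section \<open>Banach lattices\<close>

lemma abs_scaleR_nonneg:
  fixes x :: "'a::banach_lattice"
  assumes "0 \<le> c"
  shows "\<bar>c *\<^sub>R x\<bar> = c *\<^sub>R \<bar>x\<bar>"
proof (cases "c = 0")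
  case False
  have le: "\<bar>a *\<^sub>R y\<bar> \<le> a *\<^sub>R \<bar>y\<bar>" if "0 \<le> a" for a and y :: 'a
    using scaleR_left_mono[OF abs_ge_self that] scaleR_left_mono[OF abs_ge_minus_self that]
    by (intro abs_leI) (simp_all flip: scaleR_minus_right)
  \<comment> \<open>The reverse inequality is \<open>le\<close> for the factor
    \<open>inverse c\<close> at \<open>c *\<^sub>R x\<close>, multiplied by
    \<open>c\<close>.\<close>
  have "c *\<^sub>R \<bar>inverse c *\<^sub>R (c *\<^sub>R x)\<bar> \<le> c *\<^sub>R (inverse c *\<^sub>R \<bar>c *\<^sub>R x\<bar>)"
    using assms by (intro scaleR_left_mono le) auto
  with False le[OF assms, of x] show ?thesis by (simp add: order_antisym)
qed simp

lemma norm_abs_banach_lattice: "norm \<bar>x\<bar> = norm (x :: 'a::banach_lattice)"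
  by (intro order_antisym norm_mono_abs) auto

text \<open>Enlarging both coefficients to \<open>a + b\<close> gives a common positive factor,
  which can be pulled out of the infimum.\<close>

lemma inf_scaleR_le:
  fixes u v :: "'a::banach_lattice"
  assumes "0 \<le> u" "0 \<le> v" "0 \<le> a" "0 \<le> b"
  shows "inf (a *\<^sub>R u) (b *\<^sub>R v) \<le> (a + b) *\<^sub>R inf u v"
proof (cases "a + b = 0")
  case False
  with assms have pos: "0 < a + b" by simp
  let ?w = "inf (a *\<^sub>R u) (b *\<^sub>R v)"
  have "a *\<^sub>R u \<le> (a + b) *\<^sub>R u" "b *\<^sub>R v \<le> (a + b) *\<^sub>R v"
    using assms by (auto intro: scaleR_right_mono)
  then have "?w \<le> (a + b) *\<^sub>R u" "?w \<le> (a + b) *\<^sub>R v"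
    by (auto intro: le_infI1 le_infI2)
  then have "?w /\<^sub>R (a + b) \<le> inf u v"
    using pos by (simp add: pos_divideR_le_eq)
  then show ?thesis
    by (simp only: pos_divideR_le_eq[OF pos])
qed (use assms in \<open>auto simp: add_nonneg_eq_0_iff\<close>)

text \<open>The modulus is additive up to twice the overlap. The triangle inequality bounds the
  supremum of the moduli by \<open>\<bar>a + b\<bar>\<close> plus their infimum, and supremum plus
  infimum is the sum.\<close>

lemma abs_add_ge_abs_inf:
  fixes a b :: "'a::lattice_ab_group_add_abs"
  shows "\<bar>a\<bar> + \<bar>b\<bar> \<le> \<bar>a + b\<bar> + (inf (\<bar>a\<bar>) (\<bar>b\<bar>) + inf (\<bar>a\<bar>) (\<bar>b\<bar>))"
proof -
  have "\<bar>a\<bar> \<le> \<bar>a + b\<bar> + \<bar>b\<bar>" "\<bar>b\<bar> \<le> \<bar>a + b\<bar> + \<bar>a\<bar>"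
    using abs_triangle_ineq4[of "a + b" b] abs_triangle_ineq4[of "a + b" a] by simp_all
  then have "sup (\<bar>a\<bar>) (\<bar>b\<bar>) \<le> \<bar>a + b\<bar> + inf (\<bar>a\<bar>) (\<bar>b\<bar>)"
    by (simp add: add_inf_distrib_left)
  then have "sup (\<bar>a\<bar>) (\<bar>b\<bar>) + inf (\<bar>a\<bar>) (\<bar>b\<bar>)
      \<le> \<bar>a + b\<bar> + inf (\<bar>a\<bar>) (\<bar>b\<bar>) + inf (\<bar>a\<bar>) (\<bar>b\<bar>)"
    by (rule add_right_mono)
  then show ?thesis
    by (simp add: add_eq_inf_sup[of "\<bar>a\<bar>" "\<bar>b\<bar>"] add.assoc)
qed

section \<open>Positive functionals\<close>

definition positive_functional :: "('a::banach_lattice \<Rightarrow>\<^sub>L real) \<Rightarrow> bool" where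
  "positive_functional F \<longleftrightarrow> (\<forall>u\<ge>0. 0 \<le> blinfun_apply F u)"

lemma positive_functional_mono:
  "positive_functional F \<Longrightarrow> u \<le> v \<Longrightarrow> blinfun_apply F u \<le> blinfun_apply F v"
  using blinfun.diff_right[of F v u] unfolding positive_functional_def
  by (metis diff_ge_0_iff_ge)

lemma positive_functional_nonneg: "positive_functional F \<Longrightarrow> 0 \<le> u \<Longrightarrow> 0 \<le> blinfun_apply F u"
  by (simp add: positive_functional_def)

text \<open>This reduces weak nullity of nonnegative nets to positive functionals, for which order
  estimates are available.\<close>

lemma positive_functional_dominating:
  fixes \<phi> :: "'a::banach_lattice \<Rightarrow>\<^sub>L real"
  obtains F where "positive_functional F" and "\<And>u. 0 \<le> u \<Longrightarrow> \<bar>blinfun_apply \<phi> u\<bar> \<le> blinfun_apply F u"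
proof -
  let ?p = "\<lambda>x::'a. norm x * norm \<phi>"
  \<comment> \<open>The cone encodes \<open>F u \<ge> \<phi> y\<close> for \<open>\<bar>y\<bar> \<le> u\<close>, so the modulus of \<open>\<phi>\<close> itself is not needed.\<close>
  let ?K = "{(u, blinfun_apply \<phi> y) |u y. - u \<le> y \<and> y \<le> u}"
  have p: "sublinear ?p"
    by (auto simp: sublinear_def mult_ac norm_triangle_ineq simp flip: distrib_right intro!: mult_left_mono)
  have K: "convex_cone ?K"
  proof (rule convex_cone_prodI)
    show "(0, 0) \<in> ?K"
      by (auto intro!: exI[of _ 0] simp: blinfun.zero_right)
    show "(u + u', t + t') \<in> ?K" if ut: "(u, t) \<in> ?K" "(u', t') \<in> ?K" for u t u' t'
    proof -
      from ut obtain y y' where y: "t = blinfun_apply \<phi> y" "t' = blinfun_apply \<phi> y'"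
        "- u \<le> y" "y \<le> u" "- u' \<le> y'" "y' \<le> u'"
        by blast
      have "- (u + u') \<le> y + y'" "y + y' \<le> u + u'"
        using add_mono[OF y(3,5)] add_mono[OF y(4,6)] by (simp_all add: add.commute)
      with y(1,2) show ?thesis by (auto intro!: exI[of _ "y + y'"] simp: blinfun.add_right)
    qed
    show "(c *\<^sub>R u, c *\<^sub>R t) \<in> ?K" if c: "0 \<le> c" and ut: "(u, t) \<in> ?K" for c u t
    proof -
      from ut obtain y where y: "t = blinfun_apply \<phi> y" "- u \<le> y" "y \<le> u" by blast
      have "- (c *\<^sub>R u) \<le> c *\<^sub>R y" "c *\<^sub>R y \<le> c *\<^sub>R u"
        using scaleR_left_mono[OF y(2) c] scaleR_left_mono[OF y(3) c] by simp_all
      with y(1) show ?thesis by (auto intro!: exI[of _ "c *\<^sub>R y"] simp: blinfun.scaleR_right)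
    qed
  qed
  have dom: "t \<le> ?p s" if "(s, t) \<in> ?K" for s t
  proof -
    from that obtain y where y: "t = blinfun_apply \<phi> y" "- s \<le> y" "y \<le> s" by blast
    then have "\<bar>y\<bar> \<le> s" by (intro abs_leI) (auto simp: minus_le_iff)
    then have "norm y \<le> norm s"
      by (intro norm_mono_abs order_trans[OF _ abs_ge_self])
    then have "norm \<phi> * norm y \<le> ?p s" by (metis mult.commute mult_right_mono norm_ge_zero)
    with norm_blinfun[of \<phi> y] y(1) show ?thesis by simp
  qed
  obtain F where F: "\<And>s t. (s, t) \<in> ?K \<Longrightarrow> t \<le> blinfun_apply F s"
    using blinfun_between_cone_and_sublinear[OF p K dom order_refl] by blast
  have F_ge: "blinfun_apply \<phi> y \<le> blinfun_apply F u" if "- u \<le> y" "y \<le> u" for y u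
    using that by (intro F) blast
  show thesis
  proof
    show "positive_functional F"
      \<comment> \<open>The choice \<open>y = 0\<close> gives positivity; \<open>y = u\<close> and
        \<open>y = - u\<close> give the bound on \<open>\<phi>\<close> below.\<close>
      unfolding positive_functional_def using F_ge[of _ 0] by (simp add: blinfun.zero_right)
    show "\<bar>blinfun_apply \<phi> u\<bar> \<le> blinfun_apply F u" if "0 \<le> u" for u
    proof -
      have "- u \<le> u" using that by (simp add: minus_le_self_iff)
      then show ?thesis
        using F_ge[of u u] F_ge[of u "- u"] by (simp add: blinfun.minus_right)
    qed
  qed
qed

lemma positive_functional_abs_scaleR:
  fixes F :: "'a::banach_lattice \<Rightarrow>\<^sub>L real"
  shows "0 \<le> c \<Longrightarrow> blinfun_apply F \<bar>c *\<^sub>R x\<bar> = c * blinfun_apply F \<bar>x\<bar>"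
  by (simp add: abs_scaleR_nonneg blinfun.scaleR_right)

lemma sublinear_positive_functional_abs:
  fixes F :: "'a::banach_lattice \<Rightarrow>\<^sub>L real"
  assumes "positive_functional F"
  shows "sublinear (\<lambda>x. blinfun_apply F \<bar>x\<bar>)"
  using positive_functional_mono[OF assms abs_triangle_ineq]
  by (simp add: sublinear_def positive_functional_abs_scaleR blinfun.add_right)

section \<open>Almost disjoint sequences and lower \<open>\<ell>\<^sup>1\<close> estimates\<close>

text \<open>Adding the term with index \<open>k\<close> raises \<open>F\<close> of the modulus by
  \<open>c k\<close>, up to twice an overlap. The overlaps decay geometrically, so at most half of
  the coefficient sum is lost.\<close>

lemma almost_disjoint_lower_bound:
  fixes F :: "'a::banach_lattice \<Rightarrow>\<^sub>L real" and y :: "nat \<Rightarrow> 'a"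
  assumes F: "positive_functional F" and y: "\<And>k. blinfun_apply F \<bar>y k\<bar> = 1"
    and disj: "\<And>k. blinfun_apply F (inf (\<Sum>i<k. \<bar>y i\<bar>) \<bar>y k\<bar>) \<le> (1/2)^k / 8"
    and c: "\<And>i. 0 \<le> c i"
  shows "(\<Sum>i<n. c i) / 2 \<le> blinfun_apply F \<bar>\<Sum>i<n. c i *\<^sub>R y i\<bar>"
proof -
  define C where "C k = (\<Sum>i<k. c i)" for k
  define U where "U k = (\<Sum>i<k. \<bar>y i\<bar>)" for k
  define S where "S k = (\<Sum>i<k. c i *\<^sub>R y i)" for k
  have C_nonneg: "0 \<le> C k" and U_nonneg: "0 \<le> U k" for k
    using c by (auto simp: C_def U_def intro!: sum_nonneg)
  \<comment> \<open>This crude bound turns the overlap of \<open>S k\<close> with the next term into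
    the overlap of \<open>U k\<close> with \<open>\<bar>y k\<bar>\<close>, which \<open>disj\<close>
    controls.\<close>
  have S_le: "\<bar>S k\<bar> \<le> C k *\<^sub>R U k" for k
  proof -
    have "\<bar>S k\<bar> \<le> (\<Sum>i<k. \<bar>c i *\<^sub>R y i\<bar>)"
      unfolding S_def by (rule sum_abs)
    also have "\<dots> \<le> (\<Sum>i<k. C k *\<^sub>R \<bar>y i\<bar>)"
      unfolding C_def using c
      by (intro sum_mono) (auto simp: abs_scaleR_nonneg intro!: scaleR_right_mono member_le_sum)
    finally show ?thesis by (simp add: U_def scaleR_sum_right)
  qed
  \<comment> \<open>All errors so far are charged at the current total \<open>C k\<close>. As
    \<open>C\<close> is nondecreasing, old errors only grow under this accounting, and step
    \<open>k\<close> adds \<open>C (Suc k) * (1/2)^k / 4\<close>.\<close>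
  have "C k - C k * (\<Sum>i<k. (1/2)^i / 4) \<le> blinfun_apply F \<bar>S k\<bar>" for k
  proof (induction k)
    case 0
    show ?case by (simp add: C_def S_def blinfun.zero_right)
  next
    case (Suc k)
    let ?I = "inf \<bar>S k\<bar> \<bar>c k *\<^sub>R y k\<bar>"
    have "?I \<le> inf (C k *\<^sub>R U k) (c k *\<^sub>R \<bar>y k\<bar>)"
      using S_le c by (intro inf_mono) (simp_all add: abs_scaleR_nonneg)
    also have "\<dots> \<le> (C k + c k) *\<^sub>R inf (U k) \<bar>y k\<bar>"
      using C_nonneg U_nonneg c by (intro inf_scaleR_le) auto
    finally have "blinfun_apply F ?I \<le> C (Suc k) * blinfun_apply F (inf (U k) \<bar>y k\<bar>)"
      using positive_functional_mono[OF F] by (fastforce simp: C_def blinfun.scaleR_right)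
    also have "\<dots> \<le> C (Suc k) * ((1/2)^k / 8)"
      using disj C_nonneg unfolding U_def by (intro mult_left_mono)
    finally have I: "2 * blinfun_apply F ?I \<le> C (Suc k) * ((1/2)^k / 4)" by simp
    have "blinfun_apply F (\<bar>S k\<bar> + \<bar>c k *\<^sub>R y k\<bar>) \<le> blinfun_apply F (\<bar>S k + c k *\<^sub>R y k\<bar> + (?I + ?I))"
      by (intro positive_functional_mono[OF F] abs_add_ge_abs_inf)
    then have "blinfun_apply F \<bar>S k\<bar> + c k \<le> blinfun_apply F \<bar>S (Suc k)\<bar> + 2 * blinfun_apply F ?I"
      by (simp add: blinfun.add_right positive_functional_abs_scaleR c y S_def)
    moreover have "C k * (\<Sum>i<k. (1/2)^i / 4) \<le> C (Suc k) * (\<Sum>i<k. (1/2)^i / 4)"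
      using c by (intro mult_right_mono sum_nonneg) (auto simp: C_def)
    ultimately show ?case
      using Suc I by (simp add: C_def distrib_left)
  qed
  from this[of n] have "C n - C n * (\<Sum>i<n. (1/2)^i / 4) \<le> blinfun_apply F \<bar>S n\<bar>" .
  \<comment> \<open>The divisor 8 in \<open>disj\<close>, doubled overlap included, makes the total
    relative error at most a quarter of 2.\<close>
  moreover have "(\<Sum>i<n. (1/2)^i / 4) \<le> (1/2::real)"
    by (simp add: geometric_sum flip: sum_divide_distrib)
  then have "C n * (\<Sum>i<n. (1/2)^i / 4) \<le> C n * (1/2)"
    using C_nonneg by (intro mult_left_mono)
  ultimately show ?thesis by (simp add: C_def S_def)
qed

text \<open>The lower bound says that the cone spanned by the pairs \<open>(y k, 1/2)\<close> lies
  under \<open>F \<bar>\<cdot>\<bar>\<close>, which is what the Hahn--Banach statement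
  requires.\<close>

lemma almost_disjoint_functional:
  fixes F :: "'a::banach_lattice \<Rightarrow>\<^sub>L real" and y :: "nat \<Rightarrow> 'a"
  assumes F: "positive_functional F" and y: "\<And>k. blinfun_apply F \<bar>y k\<bar> = 1"
    and disj: "\<And>k. blinfun_apply F (inf (\<Sum>i<k. \<bar>y i\<bar>) \<bar>y k\<bar>) \<le> (1/2)^k / 8"
  obtains g :: "'a \<Rightarrow>\<^sub>L real" where "\<And>k. 1/2 \<le> blinfun_apply g (y k)"
proof -
  let ?p = "\<lambda>x. blinfun_apply F \<bar>x\<bar>"
  \<comment> \<open>For nonnegative \<open>c\<close>, eventually constant coefficient sums mean
    finite support; "eventually" spares matching the lengths of two combinations when they are
    added.\<close>
  let ?E = "\<lambda>c s t. \<forall>\<^sub>F n in sequentially. s = (\<Sum>i<n. c i *\<^sub>R y i) \<and> t = (\<Sum>i<n. c i) / 2"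
  let ?K = "{(s, t). \<exists>c. (\<forall>i. 0 \<le> c i) \<and> ?E c s t}"
  have K: "convex_cone ?K"
  proof (rule convex_cone_prodI)
    show "(0, 0) \<in> ?K"
      by (auto intro!: exI[of _ "\<lambda>_. 0"])
    show "(s + s', t + t') \<in> ?K" if st: "(s, t) \<in> ?K" "(s', t') \<in> ?K" for s t s' t'
    proof -
      from st obtain c d where cd: "\<And>i. 0 \<le> c i" "\<And>i. 0 \<le> d i" and E: "?E c s t" "?E d s' t'"
        by auto
      from E have "?E (\<lambda>i. c i + d i) (s + s') (t + t')"
        by eventually_elim (simp add: scaleR_left_distrib sum.distrib add_divide_distrib)
      with cd show ?thesis by (auto intro!: exI[of _ "\<lambda>i. c i + d i"])
    qed
    show "(a *\<^sub>R s, a *\<^sub>R t) \<in> ?K" if a: "0 \<le> a" and st: "(s, t) \<in> ?K" for a s t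
    proof -
      from st obtain c where c: "\<And>i. 0 \<le> c i" and E: "?E c s t" by auto
      from E have "?E (\<lambda>i. a * c i) (a *\<^sub>R s) (a *\<^sub>R t)"
        by eventually_elim (simp add: scaleR_sum_right flip: sum_distrib_left)
      with a c show ?thesis by (auto intro!: exI[of _ "\<lambda>i. a * c i"])
    qed
  qed
  have dom: "t \<le> ?p s" if st: "(s, t) \<in> ?K" for s t
  proof -
    from st obtain c where c: "\<And>i. 0 \<le> c i" and "?E c s t" by auto
    then obtain n where "s = (\<Sum>i<n. c i *\<^sub>R y i)" "t = (\<Sum>i<n. c i) / 2"
      by (auto simp: eventually_sequentially)
    with almost_disjoint_lower_bound[of F y c n, OF F y disj c] show ?thesis by simp
  qed
  have bound: "?p x \<le> norm x * norm F" for x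
    using norm_blinfun[of F "\<bar>x\<bar>"] by (simp add: norm_abs_banach_lattice mult.commute)
  obtain g :: "'a \<Rightarrow>\<^sub>L real" where g: "\<And>s t. (s, t) \<in> ?K \<Longrightarrow> t \<le> blinfun_apply g s"
    using blinfun_between_cone_and_sublinear[OF sublinear_positive_functional_abs[OF F] K dom bound]
    by blast
  show thesis
  proof
    fix k
    let ?c = "\<lambda>i::nat. if i = k then 1 else 0 :: real"
    have "?E ?c (y k) (1/2)"
      using eventually_gt_at_top[of k]
      by eventually_elim (simp add: if_distrib[of "\<lambda>a. a *\<^sub>R _"] sum.delta cong: if_cong)
    then have "(y k, 1/2) \<in> ?K"
      by (auto intro!: exI[of _ ?c])
    then show "1/2 \<le> blinfun_apply g (y k)" by (rule g)
  qed
qed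

text \<open>Greedy choice: with the sum of the moduli chosen so far as \<open>u\<close>,
  \<open>lim\<close> makes the next overlap small at all late indices, and \<open>P\<close> holds at
  some of them.\<close>

lemma almost_disjoint_subsequence:
  fixes F :: "'a::banach_lattice \<Rightarrow>\<^sub>L real" and y :: "nat \<Rightarrow> 'a"
  assumes lim: "\<And>u. 0 \<le> u \<Longrightarrow> (\<lambda>n. blinfun_apply F (inf \<bar>y n\<bar> u)) \<longlonglongrightarrow> 0"
    and freq: "\<exists>\<^sub>F n in sequentially. P n"
  obtains r :: "nat \<Rightarrow> nat" where "strict_mono r" and "\<And>k. P (r k)"
    and "\<And>k. blinfun_apply F (inf (\<Sum>i<k. \<bar>y (r i)\<bar>) \<bar>y (r k)\<bar>) \<le> (1/2)^k / 8"
proof -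
  define ok where "ok k u n \<longleftrightarrow> P n \<and> blinfun_apply F (inf u \<bar>y n\<bar>) \<le> (1/2)^k / 8" for k u n
  have step: "\<exists>n>m. ok k u n" if "0 \<le> u" for k m u
  proof -
    have "\<forall>\<^sub>F n in sequentially. m < n \<and> blinfun_apply F (inf \<bar>y n\<bar> u) < (1/2)^k / 8"
      using order_tendstoD(2)[OF lim[OF that], of "(1/2)^k / 8"] eventually_gt_at_top[of m]
      by (auto intro: eventually_conj)
    from frequently_ex[OF frequently_eventually_frequently[OF freq this]]
    show ?thesis by (auto simp: ok_def inf_commute intro: less_imp_le)
  qed
  \<comment> \<open>The state of the recursion is an index together with the sum of the earlier moduli.\<close>
  have "\<exists>f. \<forall>k. (0 \<le> snd (f k) \<and> ok k (snd (f k)) (fst (f k)) \<and> (k = 0 \<longrightarrow> snd (f k) = 0)) \<and>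
      (fst (f k) < fst (f (Suc k)) \<and> snd (f (Suc k)) = snd (f k) + \<bar>y (fst (f k))\<bar>)"
  proof (rule dependent_nat_choice)
    from step[of 0] obtain n where "ok 0 0 n" by auto
    then show "\<exists>s. 0 \<le> snd s \<and> ok 0 (snd s) (fst s) \<and> (0 = (0::nat) \<longrightarrow> snd s = 0)"
      by (intro exI[of _ "(n, 0)"]) simp
    fix s k assume s: "0 \<le> snd s \<and> ok k (snd s) (fst s) \<and> (k = 0 \<longrightarrow> snd s = 0)"
    let ?u = "snd s + \<bar>y (fst s)\<bar>"
    have u: "0 \<le> ?u" using s by simp
    from step[OF u, of "fst s" "Suc k"] obtain n where "n > fst s" "ok (Suc k) ?u n" by auto
    with u show "\<exists>s'. (0 \<le> snd s' \<and> ok (Suc k) (snd s') (fst s') \<and> (Suc k = 0 \<longrightarrow> snd s' = 0)) \<and>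
        (fst s < fst s' \<and> snd s' = ?u)"
      by (intro exI[of _ "(n, ?u)"]) simp
  qed
  then obtain f where f: "\<And>k. ok k (snd (f k)) (fst (f k))" "snd (f 0) = 0"
    "\<And>k. fst (f k) < fst (f (Suc k))" "\<And>k. snd (f (Suc k)) = snd (f k) + \<bar>y (fst (f k))\<bar>"
    by blast
  \<comment> \<open>The clause for \<open>k = 0\<close> in the recursion invariant starts this
    induction at the empty sum.\<close>
  have U: "snd (f k) = (\<Sum>i<k. \<bar>y (fst (f i))\<bar>)" for k
    by (induction k) (use f in auto)
  show thesis
  proof
    show "strict_mono (\<lambda>k. fst (f k))"
      using f(3) by (simp add: strict_mono_Suc_iff)
  qed (use f(1) in \<open>auto simp: ok_def U\<close>)
qed

section \<open>The two implications\<close>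

lemma uaw_null_weakly_null_imp_abs_weakly_null:
  fixes x :: "nat \<Rightarrow> 'a::banach_lattice"
  assumes weak: "weakly_tendsto x 0 sequentially" and uaw: "uaw_tendsto x 0 sequentially"
  shows "weakly_tendsto (\<lambda>n. \<bar>x n\<bar>) 0 sequentially"
proof -
  \<comment> \<open>Positive functionals suffice, since one of them dominates any given functional
    on the elements \<open>\<bar>x n\<bar>\<close>.\<close>
  have main: "(\<lambda>n. blinfun_apply F \<bar>x n\<bar>) \<longlonglongrightarrow> 0" if F: "positive_functional F" for F
  proof (rule ccontr)
    assume "\<not> ?thesis"
    then obtain e where e: "e > 0" and "\<not> (\<forall>\<^sub>F n in sequentially. dist (blinfun_apply F \<bar>x n\<bar>) 0 < e)"
      unfolding tendsto_iff by blast
    then have freq: "\<exists>\<^sub>F n in sequentially. e \<le> blinfun_apply F \<bar>x n\<bar>"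
      using positive_functional_nonneg[OF F] by (simp add: frequently_def not_le)
    \<comment> \<open>The maximum with \<open>e\<close> keeps the factors bounded by
      \<open>inverse e\<close> at every index, while at the frequent indices it is the exact
      normalisation.\<close>
    define a where "a n = inverse (max e (blinfun_apply F \<bar>x n\<bar>))" for n
    define y where "y n = a n *\<^sub>R x n" for n
    have a: "0 < a n" "a n \<le> inverse e" for n
      using e by (auto simp: a_def less_max_iff_disj intro: le_imp_inverse_le)
    have y_lim: "(\<lambda>n. blinfun_apply F (inf \<bar>y n\<bar> u)) \<longlonglongrightarrow> 0" if u: "0 \<le> u" for u
    proof -
      let ?b = "1 + inverse e"
      have "inf \<bar>y n\<bar> u \<le> ?b *\<^sub>R inf \<bar>x n\<bar> u" for n
      proof -
        \<comment> \<open>Boundedness of the factors lets \<open>y\<close> inherit the decay of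
          \<open>inf \<bar>x n\<bar> u\<close>, at the cost of the constant
          \<open>?b\<close>.\<close>
        have "inf \<bar>y n\<bar> u \<le> inf (inverse e *\<^sub>R \<bar>x n\<bar>) (1 *\<^sub>R u)"
          using a[of n] by (intro inf_mono) (auto simp: y_def abs_scaleR_nonneg intro: scaleR_right_mono)
        also have "\<dots> \<le> ?b *\<^sub>R inf \<bar>x n\<bar> u"
          using inf_scaleR_le[of "\<bar>x n\<bar>" u "inverse e" 1] u e by (simp add: add.commute)
        finally show ?thesis .
      qed
      from positive_functional_mono[OF F this]
      have le: "norm (blinfun_apply F (inf \<bar>y n\<bar> u)) \<le> ?b * blinfun_apply F (inf \<bar>x n\<bar> u)" for n
        using positive_functional_nonneg[OF F, of "inf \<bar>y n\<bar> u"] u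
        by (simp add: blinfun.scaleR_right)
      have "(\<lambda>n. blinfun_apply F (inf \<bar>x n\<bar> u)) \<longlonglongrightarrow> 0"
        using uaw u by (simp add: uaw_tendsto_def weakly_tendsto_def blinfun.zero_right)
      then have "(\<lambda>n. ?b * blinfun_apply F (inf \<bar>x n\<bar> u)) \<longlonglongrightarrow> 0"
        by (rule tendsto_mult_right_zero)
      then show ?thesis
        by (rule Lim_null_comparison[OF always_eventually, rotated]) (use le in blast)
    qed
    obtain r where r: "strict_mono r"
      and big: "\<And>k. e \<le> blinfun_apply F \<bar>x (r k)\<bar>"
      and disj: "\<And>k. blinfun_apply F (inf (\<Sum>i<k. \<bar>y (r i)\<bar>) \<bar>y (r k)\<bar>) \<le> (1/2)^k / 8"
      by (rule almost_disjoint_subsequence[OF y_lim freq]) (assumption | rule that)+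
    have y_one: "blinfun_apply F \<bar>y (r k)\<bar> = 1" for k
      using big[of k] e a(1)[of "r k"]
      by (simp add: y_def a_def positive_functional_abs_scaleR max_absorb2)
    obtain g :: "'a \<Rightarrow>\<^sub>L real" where g: "\<And>k. 1/2 \<le> blinfun_apply g (y (r k))"
      by (rule almost_disjoint_functional[OF F y_one disj]) (rule that)
    have "(\<lambda>n. blinfun_apply g (x n)) \<longlonglongrightarrow> 0"
      using weak by (simp add: weakly_tendsto_def blinfun.zero_right)
    then have "(\<lambda>n. inverse e * \<bar>blinfun_apply g (x n)\<bar>) \<longlonglongrightarrow> 0"
      by (intro tendsto_mult_right_zero tendsto_rabs_zero)
    \<comment> \<open>The factors \<open>a n\<close> vary with \<open>n\<close>, but their bound is
      enough to carry nullity under \<open>g\<close> from \<open>x\<close> to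
      \<open>y\<close>.\<close>
    moreover have "\<forall>n. norm (blinfun_apply g (y n)) \<le> inverse e * \<bar>blinfun_apply g (x n)\<bar>"
      using a by (simp add: y_def blinfun.scaleR_right abs_mult mult_right_mono less_imp_le)
    ultimately have "(\<lambda>n. blinfun_apply g (y n)) \<longlonglongrightarrow> 0"
      by (rule Lim_null_comparison[OF always_eventually, rotated])
    then have "(\<lambda>k. blinfun_apply g (y (r k))) \<longlonglongrightarrow> 0"
      using LIMSEQ_subseq_LIMSEQ[OF _ r] by (simp add: o_def)
    from LIMSEQ_le_const[OF this, of "1/2"] g show False by auto
  qed
  have "(\<lambda>n. blinfun_apply \<phi> \<bar>x n\<bar>) \<longlonglongrightarrow> 0" for \<phi> :: "'a \<Rightarrow>\<^sub>L real"
  proof -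
    obtain F where F: "positive_functional F" "\<And>u. 0 \<le> u \<Longrightarrow> \<bar>blinfun_apply \<phi> u\<bar> \<le> blinfun_apply F u"
      by (rule positive_functional_dominating) (rule that)
    show ?thesis
      by (rule Lim_null_comparison[OF always_eventually main[OF F(1)]]) (use F(2) in simp)
  qed
  then show ?thesis by (simp add: weakly_tendsto_def blinfun.zero_right)
qed

text \<open>Since \<open>inf \<bar>x n\<bar> u\<close> lies between 0 and
  \<open>\<bar>x n\<bar>\<close>, a dominating positive functional squeezes its values to 0.\<close>

lemma abs_weakly_null_imp_uaw_null:
  fixes x :: "'i \<Rightarrow> 'a::banach_lattice"
  assumes "weakly_tendsto (\<lambda>n. \<bar>x n\<bar>) 0 \<F>"
  shows "uaw_tendsto x 0 \<F>"
proof -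
  have "((\<lambda>n. blinfun_apply \<phi> (inf \<bar>x n\<bar> u)) \<longlongrightarrow> 0) \<F>" if u: "0 \<le> u"
    for \<phi> :: "'a \<Rightarrow>\<^sub>L real" and u
  proof -
    obtain F where F: "positive_functional F" "\<And>u. 0 \<le> u \<Longrightarrow> \<bar>blinfun_apply \<phi> u\<bar> \<le> blinfun_apply F u"
      by (rule positive_functional_dominating) (rule that)
    have le: "\<bar>blinfun_apply \<phi> (inf \<bar>x n\<bar> u)\<bar> \<le> blinfun_apply F \<bar>x n\<bar>" for n
      using F(2)[of "inf \<bar>x n\<bar> u"] positive_functional_mono[OF F(1), of "inf \<bar>x n\<bar> u" "\<bar>x n\<bar>"] u
      by simp
    have "((\<lambda>n. blinfun_apply F \<bar>x n\<bar>) \<longlongrightarrow> 0) \<F>"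
      using assms by (simp add: weakly_tendsto_def blinfun.zero_right)
    then show ?thesis
      by (rule Lim_null_comparison[OF always_eventually, rotated]) (use le in simp)
  qed
  then show ?thesis by (simp add: uaw_tendsto_def weakly_tendsto_def blinfun.zero_right)
qed

theorem theorem2p1:
  shows "lattice_ops_seq_weakly_continuous TYPE('a::banach_lattice) \<longleftrightarrow>
    (\<forall>x :: nat \<Rightarrow> 'a. weakly_tendsto x 0 sequentially \<longrightarrow> uaw_tendsto x 0 sequentially)"
  unfolding lattice_ops_seq_weakly_continuous_def
proof (intro iffI allI impI)
  fix x :: "nat \<Rightarrow> 'a"
  assume x: "weakly_tendsto x 0 sequentially"
  show "uaw_tendsto x 0 sequentially"
    if "\<forall>x :: nat \<Rightarrow> 'a. weakly_tendsto x 0 sequentially \<longrightarrow>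
      weakly_tendsto (\<lambda>n. \<bar>x n\<bar>) 0 sequentially"
    by (rule abs_weakly_null_imp_uaw_null) (rule that[rule_format, OF x])
  show "weakly_tendsto (\<lambda>n. \<bar>x n\<bar>) 0 sequentially"
    if "\<forall>x :: nat \<Rightarrow> 'a. weakly_tendsto x 0 sequentially \<longrightarrow> uaw_tendsto x 0 sequentially"
    by (rule uaw_null_weakly_null_imp_abs_weakly_null[OF x that[rule_format, OF x]])
qed

end
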